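(* Let $(M,g)$ be a three-dimensional homogeneous Lorentzian manifold which is not symmetric and which is isometric to a non-unimodular Lie group $G$ equipped with a left-invariant Lorentzian metric. Let $\mathfrak g$ be the Lie algebra of $G$, and let $\{e_1,e_2,e_3\}$ be a pseudo-orthonormal basis of $\mathfrak g$ with $e_3$ timelike, with respect to which $\mathfrak g$ has one of the forms $\mathfrak g_5,\mathfrak g_6,\mathfrak g_7$ (with real parameters $\alpha,\beta,\gamma,\delta$) listed in the context. Then the geodesic vectors $X\in\mathfrak g$ are exactly the nonzero vectors of the following forms, where $x_1,x_2,x_3$ denote real numbers. (1) If $\mathfrak g=\mathfrak g_5$ with $(\gamma,\delta)\neq(-\beta,\alpha)$: - $x_3e_3$; - $x_1e_1+x_2e_2$ with $\alpha x_1^2+(\beta+\gamma)x_1x_2+\delta x_2^2=0$; - $x_1(\delta e_1-\gamma e_2)+x_3e_3$, only if $\alpha=\beta=0$; - $x_2(-\beta e_1+\alpha e_2)+x_3e_3$, only if $\gamma=\delta=0$; - $x_1e_1+x_2e_2\pm\sqrt{x_1^2+x_2^2}\,e_3$ with $\gamma x_1^2+(\delta-\alpha)x_1x_2-\beta x_2^2=0$. (2) If $\mathfrak g=\mathfrak g_6$ with $(\gamma,\delta)\neq(\beta,\alpha)$: - $x_1e_1$; - $x_2e_2+x_3e_3$ with $\alpha x_2^2+(\gamma-\beta)x_2x_3-\delta x_3^2=0$; - $x_1e_1+x_2(\delta e_2+\gamma e_3)$, only if $\alpha=\beta=0$; - $x_1e_1+x_3(\beta e_2+\alpha e_3)$,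 only if $\gamma=\delta=0$; - $x_1e_1+x_2e_2+x_3e_3$ with $x_3=\pm\sqrt{x_1^2+x_2^2}$ and $\gamma x_2^2+(\alpha-\delta)x_2x_3-\beta x_3^2=0$. (3) If $\mathfrak g=\mathfrak g_7$ with $\alpha=0\neq\gamma$: - $x_1e_1$; - $x_2(e_2+e_3)$; - $-\frac{\delta}{\gamma}(x_2-x_3)e_1+x_2e_2+x_3e_3$, only if $\beta=0$; - $\left(\frac{\beta+\gamma}{\delta}x_2-\frac{\beta-\gamma}{\delta}x_3\right)e_1+x_2e_2+x_3e_3$ with $[(\beta+\gamma)^2+\delta^2]x_2^2-2(\beta^2-\gamma^2)x_2x_3+[(\beta-\gamma)^2-\delta^2]x_3^2=0$. (4) If $\mathfrak g=\mathfrak g_7$ with $\alpha\neq0=\gamma$: - $x_2(e_2+e_3)$; - $x_2(e_2-e_3)$, only if $\beta=0$; - $x_3\left\{2\beta(\alpha-\delta)e_1+[\beta^2-(\alpha-\delta)^2]e_2+[\beta^2+(\alpha-\delta)^2]e_3\right\}$.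
   Context: The Lorentzian signature is $(+,+,-)$; $\{e_1,e_2,e_3\}$ pseudo-orthonormal with $e_3$ timelike means $\langle e_1,e_1\rangle=\langle e_2,e_2\rangle=1$, $\langle e_3,e_3\rangle=-1$, and $\langle e_i,e_j\rangle=0$ for $i\ne j$, where $\langle\cdot,\cdot\rangle$ is the Lorentzian inner product on $\mathfrak g$ determined by the left-invariant metric. "Symmetric" means that the curvature tensor is parallel with respect to the Levi-Civita connection ($\nabla R=0$). The Lie algebras are: $\mathfrak g_5$: $[e_1,e_2]=0$, $[e_1,e_3]=\alpha e_1+\beta e_2$, $[e_2,e_3]=\gamma e_1+\delta e_2$, with $\alpha+\delta\ne0$ and $\alpha\gamma+\beta\delta=0$. $\mathfrak g_6$: $[e_1,e_2]=\alpha e_2+\beta e_3$, $[e_1,e_3]=\gamma e_2+\delta e_3$, $[e_2,e_3]=0$, with $\alpha+\delta\ne0$ and $\alpha\gamma-\beta\delta=0$. $\mathfrak g_7$: $[e_1,e_2]=-\alpha e_1-\beta e_2-\beta e_3$, $[e_1,e_3]=\alpha e_1+\beta e_2+\beta e_3$, $[e_2,e_3]=\gamma e_1+\delta e_2+\delta e_3$, with $\alpha+\delta\ne0$ and $\alpha\gamma=0$. Geodesic vectors: a nonzero $X\in\mathfrak g$ is called a geodesic vector if there is a real constant $k$ (depending on $X$) such that $\langle[X,Y],X\rangle=k\,\langle X,Y\rangle$ for all $Y\in\mathfrak g$. (Geodesic vectors correspond to the geodesics through the identity that are, up to reparametrization, orbits of one-parameter subgroups of $G$.) *)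

theory Defs
  imports "HOL-Analysis.Analysis"
begin

text \<open>
  A connected Lie group with a left-invariant metric is represented by its Lie algebra: a real
  vector space with a bracket \<open>br\<close> and an inner product \<open>ip\<close>.  Left-invariant tensor fields are
  the tensors on the Lie algebra; the Levi-Civita connection preserves left-invariant
  vector fields, so it and its curvature are given by multilinear maps on the Lie algebra.
\<close>

definition lie_bracket :: "('a::real_vector \<Rightarrow> 'a \<Rightarrow> 'a) \<Rightarrow> bool" where
  "lie_bracket br \<longleftrightarrow> bilinear br \<and> (\<forall>X. br X X = 0) \<and>
     (\<forall>X Y Z. br X (br Y Z) + br Y (br Z X) + br Z (br X Y) = 0)"

text \<open>The sum below is the trace of \<open>ad X\<close>, computed in the basis \<open>B\<close>; its value does not
  depend on \<open>B\<close>.\<close>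

definition unimodular :: "('a::real_vector \<Rightarrow> 'a \<Rightarrow> 'a) \<Rightarrow> bool" where
  "unimodular br \<longleftrightarrow>
     (\<forall>B. finite B \<and> independent B \<and> span B = UNIV \<longrightarrow>
       (\<forall>X. (\<Sum>b\<in>B. representation B (br X b) b) = 0))"

definition pseudo_orthonormal_basis ::
  "('a::real_vector \<Rightarrow> 'a \<Rightarrow> real) \<Rightarrow> 'a \<Rightarrow> 'a \<Rightarrow> 'a \<Rightarrow> bool" where
  "pseudo_orthonormal_basis ip e1 e2 e3 \<longleftrightarrow>
     independent {e1, e2, e3} \<and> span {e1, e2, e3} = UNIV \<and>
     ip e1 e1 = 1 \<and> ip e2 e2 = 1 \<and> ip e3 e3 = - 1 \<and>
     ip e1 e2 = 0 \<and> ip e1 e3 = 0 \<and> ip e2 e3 = 0"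

text \<open>The existence of the basis expresses dimension three and signature \<open>(+,+,-)\<close>.\<close>

definition lorentzian_inner_product :: "('a::real_vector \<Rightarrow> 'a \<Rightarrow> real) \<Rightarrow> bool" where
  "lorentzian_inner_product ip \<longleftrightarrow> bilinear ip \<and> (\<forall>X Y. ip X Y = ip Y X) \<and>
     (\<exists>e1 e2 e3. pseudo_orthonormal_basis ip e1 e2 e3)"

text \<open>Metric compatibility has no derivative term, since the inner product of two left-invariant
  fields is constant.\<close>

definition is_levi_civita ::
  "('a::real_vector \<Rightarrow> 'a \<Rightarrow> 'a) \<Rightarrow> ('a \<Rightarrow> 'a \<Rightarrow> real) \<Rightarrow> ('a \<Rightarrow> 'a \<Rightarrow> 'a) \<Rightarrow> bool" where
  "is_levi_civita br ip D \<longleftrightarrow> bilinear D \<and>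
     (\<forall>X Y. D X Y - D Y X = br X Y) \<and>
     (\<forall>X Y Z. ip (D X Y) Z + ip Y (D X Z) = 0)"

definition levi_civita ::
  "('a::real_vector \<Rightarrow> 'a \<Rightarrow> 'a) \<Rightarrow> ('a \<Rightarrow> 'a \<Rightarrow> real) \<Rightarrow> 'a \<Rightarrow> 'a \<Rightarrow> 'a" where
  "levi_civita br ip = (THE D. is_levi_civita br ip D)"

definition curvature ::
  "('a::real_vector \<Rightarrow> 'a \<Rightarrow> 'a) \<Rightarrow> ('a \<Rightarrow> 'a \<Rightarrow> real) \<Rightarrow> 'a \<Rightarrow> 'a \<Rightarrow> 'a \<Rightarrow> 'a" where
  "curvature br ip X Y Z = (let D = levi_civita br ip in
     D X (D Y Z) - D Y (D X Z) - D (br X Y) Z)"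

definition symmetric_metric ::
  "('a::real_vector \<Rightarrow> 'a \<Rightarrow> 'a) \<Rightarrow> ('a \<Rightarrow> 'a \<Rightarrow> real) \<Rightarrow> bool" where
  "symmetric_metric br ip \<longleftrightarrow> (let D = levi_civita br ip; R = curvature br ip in
     \<forall>W X Y Z. D W (R X Y Z) - R (D W X) Y Z - R X (D W Y) Z - R X Y (D W Z) = 0)"

definition geodesic_vector ::
  "('a::real_vector \<Rightarrow> 'a \<Rightarrow> 'a) \<Rightarrow> ('a \<Rightarrow> 'a \<Rightarrow> real) \<Rightarrow> 'a \<Rightarrow> bool" where
  "geodesic_vector br ip X \<longleftrightarrow> X \<noteq> 0 \<and> (\<exists>k::real. \<forall>Y. ip (br X Y) X = k * ip X Y)"

definition form_g5 ::
  "('a::real_vector \<Rightarrow> 'a \<Rightarrow> 'a) \<Rightarrow> 'a \<Rightarrow> 'a \<Rightarrow> 'a \<Rightarrow> real \<Rightarrow> real \<Rightarrow> real \<Rightarrow> real \<Rightarrow> bool" where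
  "form_g5 br e1 e2 e3 \<alpha> \<beta> \<gamma> \<delta> \<longleftrightarrow>
     br e1 e2 = 0 \<and>
     br e1 e3 = \<alpha> *\<^sub>R e1 + \<beta> *\<^sub>R e2 \<and>
     br e2 e3 = \<gamma> *\<^sub>R e1 + \<delta> *\<^sub>R e2 \<and>
     \<alpha> + \<delta> \<noteq> 0 \<and> \<alpha> * \<gamma> + \<beta> * \<delta> = 0"

definition form_g6 ::
  "('a::real_vector \<Rightarrow> 'a \<Rightarrow> 'a) \<Rightarrow> 'a \<Rightarrow> 'a \<Rightarrow> 'a \<Rightarrow> real \<Rightarrow> real \<Rightarrow> real \<Rightarrow> real \<Rightarrow> bool" where
  "form_g6 br e1 e2 e3 \<alpha> \<beta> \<gamma> \<delta> \<longleftrightarrow>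
     br e1 e2 = \<alpha> *\<^sub>R e2 + \<beta> *\<^sub>R e3 \<and>
     br e1 e3 = \<gamma> *\<^sub>R e2 + \<delta> *\<^sub>R e3 \<and>
     br e2 e3 = 0 \<and>
     \<alpha> + \<delta> \<noteq> 0 \<and> \<alpha> * \<gamma> - \<beta> * \<delta> = 0"

definition form_g7 ::
  "('a::real_vector \<Rightarrow> 'a \<Rightarrow> 'a) \<Rightarrow> 'a \<Rightarrow> 'a \<Rightarrow> 'a \<Rightarrow> real \<Rightarrow> real \<Rightarrow> real \<Rightarrow> real \<Rightarrow> bool" where
  "form_g7 br e1 e2 e3 \<alpha> \<beta> \<gamma> \<delta> \<longleftrightarrow>
     br e1 e2 = - \<alpha> *\<^sub>R e1 - \<beta> *\<^sub>R e2 - \<beta> *\<^sub>R e3 \<and>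
     br e1 e3 = \<alpha> *\<^sub>R e1 + \<beta> *\<^sub>R e2 + \<beta> *\<^sub>R e3 \<and>
     br e2 e3 = \<gamma> *\<^sub>R e1 + \<delta> *\<^sub>R e2 + \<delta> *\<^sub>R e3 \<and>
     \<alpha> + \<delta> \<noteq> 0 \<and> \<alpha> * \<gamma> = 0"

lemma pseudo_orthonormal_expansion:
  assumes "bilinear ip" "\<forall>X Y. ip X Y = ip Y X" "pseudo_orthonormal_basis ip e1 e2 e3"
  shows "X = ip X e1 *\<^sub>R e1 + ip X e2 *\<^sub>R e2 - ip X e3 *\<^sub>R e3"
proof -
  have b: "ip e1 e1 = 1" "ip e2 e2 = 1" "ip e3 e3 = -1" "ip e1 e2 = 0" "ip e1 e3 = 0" "ip e2 e3 = 0"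
    "span {e1, e2, e3} = UNIV"
    using assms(3) by (auto simp: pseudo_orthonormal_basis_def)
  have b': "ip e2 e1 = 0" "ip e3 e1 = 0" "ip e3 e2 = 0" using b assms(2) by metis+
  have "X \<in> span {e1, e2, e3}" using b by simp
  then obtain a b c where X: "X = a *\<^sub>R e1 + b *\<^sub>R e2 + c *\<^sub>R e3"
    by (auto simp: span_insert span_singleton algebra_simps)
  have l: "ip (x + y) z = ip x z + ip y z" "ip (r *\<^sub>R x) z = r * ip x z" for x y z r
    using assms(1) by (auto simp: bilinear_ladd bilinear_lmul)
  show ?thesis unfolding X l b b' by simp
qed

lemma levi_civita_ex1:
  assumes br: "lie_bracket br" and ip: "lorentzian_inner_product ip"
  shows "\<exists>!D. is_levi_civita br ip D"
proof -
  have bb: "bilinear br" and alt: "\<And>X. br X X = 0" using br by (auto simp: lie_bracket_def)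
  have bi: "bilinear ip" and sym: "\<And>X Y. ip X Y = ip Y X"
    using ip unfolding lorentzian_inner_product_def by blast+
  obtain e1 e2 e3 where e: "pseudo_orthonormal_basis ip e1 e2 e3"
    using ip by (auto simp: lorentzian_inner_product_def)
  note br_s = bilinear_ladd[OF bb] bilinear_radd[OF bb] bilinear_lmul[OF bb] bilinear_rmul[OF bb]
  note ip_s = bilinear_ladd[OF bi] bilinear_radd[OF bi] bilinear_lmul[OF bi] bilinear_rmul[OF bi]
    bilinear_lsub[OF bi] bilinear_rsub[OF bi]
  have ex: "X = ip X e1 *\<^sub>R e1 + ip X e2 *\<^sub>R e2 - ip X e3 *\<^sub>R e3" for X
    using pseudo_orthonormal_expansion[OF bi _ e] sym by blast
  have skew: "br Y X = - br X Y" for X Y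
    using alt[of "X + Y"] alt[of X] alt[of Y] by (simp add: br_s eq_neg_iff_add_eq_0 add.commute)
  have ipneg: "ip (- X) Y = - ip X Y" "ip X (- Y) = - ip X Y" for X Y
    using bilinear_lneg[OF bi] bilinear_rneg[OF bi] by auto
  have nondeg: "X = Y" if "\<And>Z. ip X Z = ip Y Z" for X Y
    using ex[of X] ex[of Y] that by metis
  define K where "K X Y Z = (ip (br X Y) Z - ip (br Y Z) X + ip (br Z X) Y) / 2" for X Y Z
  define D where "D X Y = K X Y e1 *\<^sub>R e1 + K X Y e2 *\<^sub>R e2 - K X Y e3 *\<^sub>R e3" for X Y
  have KZ: "K X Y (a *\<^sub>R u + b *\<^sub>R v - c *\<^sub>R w) = a * K X Y u + b * K X Y v - c * K X Y w"
    for X Y a b c u v w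
    unfolding K_def br_s ip_s bilinear_lsub[OF bb] bilinear_rsub[OF bb] real_scaleR_def
    by (simp add: field_simps)
  have DK: "ip (D X Y) Z = K X Y Z" for X Y Z
  proof -
    have "K X Y Z = ip Z e1 * K X Y e1 + ip Z e2 * K X Y e2 - ip Z e3 * K X Y e3"
      using KZ ex[of Z] by metis
    also have "\<dots> = ip (D X Y) Z" by (simp add: D_def ip_s sym)
    finally show ?thesis by simp
  qed
  have "bilinear D"
    unfolding bilinear_def linear_iff D_def K_def
    by (auto simp: br_s ip_s algebra_simps add_divide_distrib diff_divide_distrib)
  moreover have "D X Y - D Y X = br X Y" for X Y
  proof (rule nondeg)
    fix Z show "ip (D X Y - D Y X) Z = ip (br X Y) Z"
      using skew[of Y X] skew[of Y Z] skew[of X Z] by (simp add: ip_s DK K_def ipneg field_simps)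
  qed
  moreover have "ip (D X Y) Z + ip Y (D X Z) = 0" for X Y Z
  proof -
    have "ip Y (D X Z) = K X Z Y" using DK sym by metis
    then show ?thesis
      using skew[of Y Z] skew[of X Y] skew[of X Z]
      by (simp add: DK K_def ipneg field_simps)
  qed
  ultimately have "is_levi_civita br ip D" by (simp add: is_levi_civita_def)
  moreover have "D' = D" if "is_levi_civita br ip D'" for D'
  proof (intro ext nondeg)
    fix X Y Z
    have t: "br X Y = D' X Y - D' Y X" for X Y using that by (auto simp: is_levi_civita_def)
    have m: "ip (D' X Y) Z = - ip (D' X Z) Y" for X Y Z
      using that sym by (metis is_levi_civita_def eq_neg_iff_add_eq_0)
    show "ip (D' X Y) Z = ip (D X Y) Z"
      unfolding DK K_def t ip_s using m[of X Y Z] m[of Y Z X] m[of Z X Y] by simp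
  qed
  ultimately show ?thesis by blast
qed

lemma is_levi_civita_levi_civita:
  "lie_bracket br \<Longrightarrow> lorentzian_inner_product ip \<Longrightarrow> is_levi_civita br ip (levi_civita br ip)"
  unfolding levi_civita_def by (rule theI'[OF levi_civita_ex1])

end

theory Submission
  imports Defs
begin

text \<open>
  Write \<open>X = x1 e1 + x2 e2 + x3 e3\<close>.  Both sides of \<open>\<langle>[X,Y],X\<rangle> = k \<langle>X,Y\<rangle>\<close> are linear in \<open>Y\<close>, so \<open>X\<close>
  is a geodesic vector iff the condition holds for \<open>Y = e1, e2, e3\<close>: three quadratic equations in
  \<open>x1, x2, x3\<close> that share the unknown \<open>k\<close>
  (\<open>geodesic_vector_coordinates\<close>).  The choice \<open>Y = X\<close> gives \<open>k \<langle>X,X\<rangle> = 0\<close>, so that either \<open>k = 0\<close>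
  or \<open>X\<close> is null, and this dichotomy produces the families of the classification.

  For \<open>\<gg>\<^sub>5\<close> and \<open>\<gg>\<^sub>6\<close> two of the basis vectors span an abelian ideal, on which the third one acts
  by a linear map.  Outside this ideal and its orthogonal line, the component of \<open>X\<close> in the ideal is
  an eigenvector of the metric adjoint of this map when \<open>X\<close> is null, and lies in the kernel of the
  adjoint when \<open>k = 0\<close>.  A nonzero kernel is where the parameter relation enters: it means that the
  images of the two basis vectors are dependent, and the relation says that they are orthogonal.
  For \<open>\<gg>\<^sub>5\<close> they lie in a Euclidean plane, so one of them vanishes.  For \<open>\<gg>\<^sub>6\<close> they lie in a
  Lorentzian plane and can also be on one null line.  For \<open>\<gg>\<^sub>7\<close> the
  last two equations add up to one divisible by \<open>\<langle>X, e2 + e3\<rangle> = x2 - x3\<close>; if this number is not zero,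
  the quotient determines \<open>k\<close>.

  Some parameter values admit geodesic vectors outside the listed families.  In \<open>\<gg>\<^sub>6\<close> this can
  only happen when both images are on one null line; in \<open>\<gg>\<^sub>7\<close> with \<open>\<alpha> \<noteq> 0 = \<gamma>\<close> it happens when
  \<open>\<delta> = 0\<close> and when \<open>\<alpha> = \<delta>\<close>, \<open>\<beta> = 0\<close>.  In all these cases the metric is shown to be symmetric
  (\<open>symmetric_g6\<close>, \<open>symmetric_g7\<close>), which contradicts the hypothesis.  In a frame \<open>e, u, v\<close> with \<open>e\<close>
  a unit vector orthogonal to two null vectors \<open>u, v\<close> these algebras have simple brackets and
  Levi-Civita connections.  They are, in this order, a space of constant curvature, a plane wave with
  parallel curvature, and a flat space.
\<close>

section \<open>Levi-Civita connection and curvature on a Lorentzian Lie algebra\<close>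

locale lorentzian_lie_algebra =
  fixes br :: "'a::real_vector \<Rightarrow> 'a \<Rightarrow> 'a" and ip :: "'a \<Rightarrow> 'a \<Rightarrow> real"
  assumes lie: "lie_bracket br" and lorentzian: "lorentzian_inner_product ip"
begin

lemma ip_bilinear: "bilinear ip" and ip_commute: "ip X Y = ip Y X"
  using lorentzian unfolding lorentzian_inner_product_def by blast+

lemma br_bilinear: "bilinear br" and br_self: "br X X = 0"
  using lie unfolding lie_bracket_def by blast+

lemmas ip_simps =
  bilinear_ladd[OF ip_bilinear] bilinear_radd[OF ip_bilinear]
  bilinear_lsub[OF ip_bilinear] bilinear_rsub[OF ip_bilinear]
  bilinear_lmul[OF ip_bilinear] bilinear_rmul[OF ip_bilinear]
  bilinear_lneg[OF ip_bilinear] bilinear_rneg[OF ip_bilinear]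
  bilinear_lzero[OF ip_bilinear] bilinear_rzero[OF ip_bilinear]

lemmas br_simps =
  bilinear_ladd[OF br_bilinear] bilinear_radd[OF br_bilinear]
  bilinear_lsub[OF br_bilinear] bilinear_rsub[OF br_bilinear]
  bilinear_lmul[OF br_bilinear] bilinear_rmul[OF br_bilinear]
  bilinear_lneg[OF br_bilinear] bilinear_rneg[OF br_bilinear]
  bilinear_lzero[OF br_bilinear] bilinear_rzero[OF br_bilinear]

lemma br_skew: "br Y X = - br X Y"
  using br_self[of "X + Y"] br_self[of X] br_self[of Y]
  by (simp add: br_simps eq_neg_iff_add_eq_0 add.commute)

declare br_self [simp]

text \<open>By uniqueness, a connection that is guessed and then checked to be metric and torsion-free may
  replace the definite description, so that the Koszul formula can be avoided.\<close>

lemma levi_civita_eqI: "is_levi_civita br ip D \<Longrightarrow> levi_civita br ip = D"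
  unfolding levi_civita_def by (rule the1_equality[OF levi_civita_ex1[OF lie lorentzian]])

text \<open>The curvature tensor is then built from the inner product and the identity alone, and both
  are parallel.\<close>

lemma constant_curvature_imp_symmetric:
  assumes D: "is_levi_civita br ip D"
    and curv: "\<And>X Y Z. D X (D Y Z) - D Y (D X Z) - D (br X Y) Z
                 = K *\<^sub>R (ip Y Z *\<^sub>R X - ip X Z *\<^sub>R Y)"
  shows "symmetric_metric br ip"
proof -
  have bil: "bilinear D" and metric: "\<And>X Y Z. ip (D X Y) Z = - ip Y (D X Z)"
    using D by (auto simp: is_levi_civita_def eq_neg_iff_add_eq_0)
  show ?thesis
    unfolding symmetric_metric_def curvature_def Let_def levi_civita_eqI[OF D] curv
    by (simp add: bilinear_rsub[OF bil] bilinear_rmul[OF bil] metric algebra_simps)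
qed

section \<open>Three symmetric metrics in null frames\<close>

text \<open>The normalisation \<open>\<langle>u,v\<rangle> = 2\<close> is the one of \<open>e2 \<plusminus> e3\<close> for a pseudo-orthonormal basis; the
  components along \<open>u\<close> and \<open>v\<close> are read off by pairing with the other null vector.\<close>

definition null_frame :: "'a \<Rightarrow> 'a \<Rightarrow> 'a \<Rightarrow> bool" where
  "null_frame e u v \<longleftrightarrow>
     ip e e = 1 \<and> ip u v = 2 \<and> ip u u = 0 \<and> ip v v = 0 \<and> ip e u = 0 \<and> ip e v = 0 \<and>
     (\<forall>X. X = ip X e *\<^sub>R e + (ip X v / 2) *\<^sub>R u + (ip X u / 2) *\<^sub>R v)"

end

locale null_framed_lie_algebra = lorentzian_lie_algebra +
  fixes e u v :: 'a
  assumes frame: "null_frame e u v"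
begin

lemma ip_frame [simp]:
  "ip e e = 1" "ip u v = 2" "ip v u = 2" "ip u u = 0" "ip v v = 0"
  "ip e u = 0" "ip u e = 0" "ip e v = 0" "ip v e = 0"
  using frame ip_commute unfolding null_frame_def by metis+

lemma frame_expansion: "X = ip X e *\<^sub>R e + (ip X v / 2) *\<^sub>R u + (ip X u / 2) *\<^sub>R v"
  using frame unfolding null_frame_def by blast

lemma frame_eqI: "X = Y" if "ip X e = ip Y e" "ip X u = ip Y u" "ip X v = ip Y v"
  using frame_expansion[of X] frame_expansion[of Y] that by simp

lemma ip_in_frame: "ip X Y = ip X e * ip Y e + (ip X u * ip Y v + ip X v * ip Y u) / 2"
proof -
  have "ip X Y = ip X (ip Y e *\<^sub>R e + (ip Y v / 2) *\<^sub>R u + (ip Y u / 2) *\<^sub>R v)"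
    using frame_expansion[of Y] by simp
  then show ?thesis by (simp add: ip_simps field_simps)
qed

lemma br_in_frame:
  "br X Y = ((ip X e * ip Y v - ip X v * ip Y e) / 2) *\<^sub>R br e u
     + ((ip X e * ip Y u - ip X u * ip Y e) / 2) *\<^sub>R br e v
     + ((ip X v * ip Y u - ip X u * ip Y v) / 4) *\<^sub>R br u v"
proof -
  have "br X Y = br (ip X e *\<^sub>R e + (ip X v / 2) *\<^sub>R u + (ip X u / 2) *\<^sub>R v)
                    (ip Y e *\<^sub>R e + (ip Y v / 2) *\<^sub>R u + (ip Y u / 2) *\<^sub>R v)"
    using frame_expansion[of X] frame_expansion[of Y] by simp
  also have "\<dots> = ((ip X e * ip Y v - ip X v * ip Y e) / 2) *\<^sub>R br e u
     + ((ip X e * ip Y u - ip X u * ip Y e) / 2) *\<^sub>R br e v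
     + ((ip X v * ip Y u - ip X u * ip Y v) / 4) *\<^sub>R br u v"
    by (simp add: br_simps br_skew[of u e] br_skew[of v e] br_skew[of v u]
        scaleR_left_diff_distrib scaleR_right_diff_distrib diff_divide_distrib
        scaleR_add_right algebra_simps)
  finally show ?thesis .
qed

text \<open>Here the derived algebra is a null line, and the metric has constant curvature \<open>- s\<^sup>2/4\<close>.  In the
  connection below \<open>S X\<close> is the derivative of \<open>e\<close> in the direction \<open>X\<close>, the map \<open>T\<close> is the derivative
  in the direction \<open>e\<close>, and the term \<open>ip (S X) Y *\<^sub>R e\<close> is forced by metric compatibility.\<close>

lemma symmetric_null_derived_line:
  assumes "br e u = s *\<^sub>R u" "br e v = t *\<^sub>R u" "br u v = 0"
  shows "symmetric_metric br ip"
proof -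
  define S where "S X = - ((s/2) *\<^sub>R (X - ip X e *\<^sub>R e) + (t/2 * ip X u) *\<^sub>R u)" for X
  define T where "T Y = (s/4) *\<^sub>R (ip Y v *\<^sub>R u - ip Y u *\<^sub>R v)" for Y
  define D where "D X Y = ip Y e *\<^sub>R S X - ip (S X) Y *\<^sub>R e + ip X e *\<^sub>R T Y" for X Y
  have De: "ip (D X Y) e = (s/4) * (ip X u * ip Y v + ip X v * ip Y u) + (t/2) * ip X u * ip Y u"
   and Du: "ip (D X Y) u = - (s/2) * ip X u * ip Y e - (s/2) * ip X e * ip Y u"
   and Dv: "ip (D X Y) v = - (s/2) * ip X v * ip Y e - t * ip X u * ip Y e
              + (s/2) * ip X e * ip Y v" for X Y
    using ip_in_frame[of X Y]
    by (simp_all add: D_def S_def T_def ip_simps ip_commute[of _ Y] field_simps)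
  note br_ip = br_in_frame[unfolded assms]
  have be: "ip (br X Y) e = 0" and bu: "ip (br X Y) u = 0"
    and bv: "ip (br X Y) v = s * (ip X e * ip Y v - ip X v * ip Y e)
        + t * (ip X e * ip Y u - ip X u * ip Y e)" for X Y
    by (subst br_ip; simp add: ip_simps field_simps)+
  have "bilinear D"
    unfolding bilinear_def linear_iff
    by (intro conjI allI; rule frame_eqI; simp add: De Du Dv ip_simps field_simps)
  moreover have "D X Y - D Y X = br X Y" for X Y
    by (rule frame_eqI; simp add: De Du Dv be bu bv ip_simps algebra_simps)
  moreover have "ip (D X Y) Z + ip Y (D X Z) = 0" for X Y Z
    by (simp add: ip_in_frame[of "D X Y" Z] ip_in_frame[of Y "D X Z"] De Du Dv field_simps)
  ultimately have "is_levi_civita br ip D" by (simp add: is_levi_civita_def)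
  moreover have "D X (D Y Z) - D Y (D X Z) - D (br X Y) Z
      = (- s\<^sup>2/4) *\<^sub>R (ip Y Z *\<^sub>R X - ip X Z *\<^sub>R Y)" for X Y Z
    by (rule frame_eqI; simp add: ip_in_frame[of X Z] ip_in_frame[of Y Z] De Du Dv be bu bv ip_simps;
        simp add: algebra_simps power2_eq_square; simp add: field_simps)
  ultimately show ?thesis by (rule constant_curvature_imp_symmetric)
qed

text \<open>The skew endomorphism \<open>J\<close> below generates the null rotations that fix \<open>u\<close>, and the connection is
  \<open>D X Y = c X *\<^sub>R J Y\<close> for a linear form \<open>c\<close>.  Hence \<open>u\<close> is parallel and the curvature is \<open>\<omega> \<otimes> J\<close>, where
  \<open>\<omega>\<close> is a multiple of the wedge product of the forms dual to \<open>e\<close> and \<open>u\<close>.  Since \<open>J u = 0\<close> and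
  \<open>J e\<close> is a multiple of \<open>u\<close>, this wedge product is invariant under \<open>J\<close>; as \<open>J\<close> commutes with
  itself, the curvature is parallel.  It does not vanish when \<open>a \<noteq> 0\<close>.\<close>

lemma symmetric_plane_wave:
  assumes "br e u = 0" "br e v = - 2 *\<^sub>R (a *\<^sub>R e + b *\<^sub>R u)" "br u v = 0"
  shows "symmetric_metric br ip"
proof -
  define c where "c X = a * ip X e + b * ip X u" for X
  define J where "J Y = ip Y e *\<^sub>R u - ip Y u *\<^sub>R e" for Y
  define D where "D X Y = c X *\<^sub>R J Y" for X Y
  have J_add: "J (X + Y) = J X + J Y"
    and J_scale: "J (r *\<^sub>R X) = r *\<^sub>R J X" for X Y r
    by (simp_all add: J_def ip_simps algebra_simps)
  have J_skew: "ip (J Y) Z = - ip Y (J Z)" for Y Z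
    by (simp add: J_def ip_simps ip_commute[of e] ip_commute[of u])
  have Ju: "ip (J X) u = 0" and Je: "ip (J X) e = - ip X u" for X
    by (simp_all add: J_def ip_simps)
  have "bilinear D"
    unfolding bilinear_def linear_iff
    by (auto simp: D_def J_add J_scale c_def ip_simps algebra_simps)
  moreover have torsion: "br X Y = D X Y - D Y X" for X Y
    by (subst br_in_frame[unfolded assms], rule frame_eqI;
        simp add: D_def J_def c_def ip_simps field_simps)
  moreover have "ip (D X Y) Z + ip Y (D X Z) = 0" for X Y Z
    by (simp add: D_def ip_simps J_skew)
  ultimately have D: "is_levi_civita br ip D" by (simp add: is_levi_civita_def)
  define \<omega> where "\<omega> X Y = a\<^sup>2 * (ip X e * ip Y u - ip X u * ip Y e)" for X Y
  have curv: "D X (D Y Z) - D Y (D X Z) - D (br X Y) Z = \<omega> X Y *\<^sub>R J Z" for X Y Z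
  proof -
    have "c (br X Y) = - \<omega> X Y"
      unfolding torsion by (simp add: D_def \<omega>_def c_def ip_simps Ju Je power2_eq_square algebra_simps)
    then show ?thesis by (simp add: D_def J_scale algebra_simps)
  qed
  have "\<omega> (D W X) Y + \<omega> X (D W Y) = 0" for W X Y
    by (simp add: \<omega>_def D_def ip_simps Ju Je algebra_simps)
  then have "\<omega> (D W X) Y *\<^sub>R J Z + \<omega> X (D W Y) *\<^sub>R J Z = 0" for W X Y Z
    by (metis scaleR_add_left scaleR_zero_left)
  then show ?thesis
    unfolding symmetric_metric_def curvature_def Let_def levi_civita_eqI[OF D] curv
    by (simp add: D_def J_scale algebra_simps)
qed

text \<open>The bracket is \<open>[X,Y] = l(X) Y - l(Y) X\<close> for the linear form \<open>l = a \<langle>u,_\<rangle>\<close>.  For a bracket of this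
  shape the metric has constant curvature \<open>- \<langle>l,l\<rangle>\<close>, here zero because \<open>u\<close> is null.\<close>

lemma symmetric_null_special_bracket:
  assumes "br e u = 0" "br e v = - 2 *\<^sub>R (a *\<^sub>R e)" "br u v = - 2 *\<^sub>R (a *\<^sub>R u)"
  shows "symmetric_metric br ip"
proof -
  define D where "D X Y = a *\<^sub>R (ip X Y *\<^sub>R u - ip Y u *\<^sub>R X)" for X Y
  have "bilinear D"
    unfolding bilinear_def linear_iff by (auto simp: D_def ip_simps algebra_simps)
  moreover have torsion: "br X Y = D X Y - D Y X" for X Y
    by (subst br_in_frame[unfolded assms], rule frame_eqI;
        simp add: D_def ip_commute[of Y X] ip_simps field_simps)
  moreover have "ip (D X Y) Z + ip Y (D X Z) = 0" for X Y Z
    by (simp add: D_def ip_simps ip_commute[of u] ip_commute[of Y X] algebra_simps)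
  ultimately have "is_levi_civita br ip D" by (simp add: is_levi_civita_def)
  moreover have "D X (D Y Z) - D Y (D X Z) - D (br X Y) Z = 0 *\<^sub>R (ip Y Z *\<^sub>R X - ip X Z *\<^sub>R Y)"
    for X Y Z
    unfolding torsion by (simp add: D_def ip_simps ip_commute[of Y X] algebra_simps)
  ultimately show ?thesis by (rule constant_curvature_imp_symmetric)
qed

end

section \<open>The geodesic equations in a pseudo-orthonormal basis\<close>

locale pseudo_orthonormal_lie_algebra = lorentzian_lie_algebra +
  fixes e1 e2 e3 :: 'a
  assumes basis: "pseudo_orthonormal_basis ip e1 e2 e3"
begin

lemma ip_basis [simp]:
  "ip e1 e1 = 1" "ip e2 e2 = 1" "ip e3 e3 = - 1"
  "ip e1 e2 = 0" "ip e2 e1 = 0" "ip e1 e3 = 0" "ip e3 e1 = 0" "ip e2 e3 = 0" "ip e3 e2 = 0"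
  using basis ip_commute unfolding pseudo_orthonormal_basis_def by metis+

lemma basis_expansion: "X = ip X e1 *\<^sub>R e1 + ip X e2 *\<^sub>R e2 - ip X e3 *\<^sub>R e3"
  using pseudo_orthonormal_expansion[OF ip_bilinear _ basis] ip_commute by blast

lemma vector_eq_iff: "X = Y \<longleftrightarrow> ip X e1 = ip Y e1 \<and> ip X e2 = ip Y e2 \<and> ip X e3 = ip Y e3"
  using basis_expansion[of X] basis_expansion[of Y] by metis

lemma exists_coordinates: obtains x1 x2 x3 where "X = x1 *\<^sub>R e1 + x2 *\<^sub>R e2 + x3 *\<^sub>R e3"
proof
  show "X = ip X e1 *\<^sub>R e1 + ip X e2 *\<^sub>R e2 + (- ip X e3) *\<^sub>R e3"
    using basis_expansion[of X] by simp
qed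

lemma null_frame_of_basis: 
  "null_frame e1 (e2 + e3) (e2 - e3)" "null_frame e1 (e2 - e3) (e2 + e3)"
  unfolding null_frame_def by (auto simp: vector_eq_iff ip_simps field_simps)

lemma geodesic_vector_coordinates:
  assumes X: "X = x1 *\<^sub>R e1 + x2 *\<^sub>R e2 + x3 *\<^sub>R e3"
  shows "geodesic_vector br ip X \<longleftrightarrow> X \<noteq> 0 \<and>
    (\<exists>k. - x2 * ip (br e1 e2) X - x3 * ip (br e1 e3) X = k * x1 \<and>
         x1 * ip (br e1 e2) X - x3 * ip (br e2 e3) X = k * x2 \<and>
         x1 * ip (br e1 e3) X + x2 * ip (br e2 e3) X = - k * x3)"
proof -
  have b: "ip (br X e1) X = - x2 * ip (br e1 e2) X - x3 * ip (br e1 e3) X"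
    "ip (br X e2) X = x1 * ip (br e1 e2) X - x3 * ip (br e2 e3) X"
    "ip (br X e3) X = x1 * ip (br e1 e3) X + x2 * ip (br e2 e3) X"
  proof -
    have "br X e1 = - (x2 *\<^sub>R br e1 e2) - x3 *\<^sub>R br e1 e3"
      "br X e2 = x1 *\<^sub>R br e1 e2 - x3 *\<^sub>R br e2 e3"
      "br X e3 = x1 *\<^sub>R br e1 e3 + x2 *\<^sub>R br e2 e3"
      by (simp_all add: X br_simps br_skew[of e2 e1] br_skew[of e3 e1] br_skew[of e3 e2])
    then show "ip (br X e1) X = - x2 * ip (br e1 e2) X - x3 * ip (br e1 e3) X"
    "ip (br X e2) X = x1 * ip (br e1 e2) X - x3 * ip (br e2 e3) X"
    "ip (br X e3) X = x1 * ip (br e1 e3) X + x2 * ip (br e2 e3) X"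
      by (simp_all add: ip_simps)
  qed
  have x: "ip X e1 = x1" "ip X e2 = x2" "ip X e3 = - x3"
    by (simp_all add: X ip_simps)
  have "(\<forall>Y. ip (br X Y) X = k * ip X Y) \<longleftrightarrow>
      ip (br X e1) X = k * x1 \<and> ip (br X e2) X = k * x2 \<and> ip (br X e3) X = - k * x3" for k
  proof (intro iffI allI)
    fix Y
    assume eqs: "ip (br X e1) X = k * x1 \<and> ip (br X e2) X = k * x2 \<and> ip (br X e3) X = - k * x3"
    obtain y1 y2 y3 where Y: "Y = y1 *\<^sub>R e1 + y2 *\<^sub>R e2 + y3 *\<^sub>R e3"
      by (rule exists_coordinates)
    show "ip (br X Y) X = k * ip X Y"
      using eqs unfolding Y by (simp add: br_simps ip_simps x algebra_simps)
  next
    assume "\<forall>Y. ip (br X Y) X = k * ip X Y"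
    then show "ip (br X e1) X = k * x1 \<and> ip (br X e2) X = k * x2 \<and> ip (br X e3) X = - k * x3"
      by (simp add: x)
  qed
  then show ?thesis unfolding geodesic_vector_def b by simp
qed

end

section \<open>Solving the geodesic equations\<close>

lemma square_eq_iff_sqrt:
  fixes x y :: real
  assumes "0 \<le> y"
  shows "x\<^sup>2 = y \<longleftrightarrow> x = sqrt y \<or> x = - sqrt y"
  using assms power2_eq_iff[of x "sqrt y"] by simp

text \<open>With \<open>A\<close> the matrix with rows \<open>(\<alpha>, \<beta>)\<close>, \<open>(\<gamma>, \<delta>)\<close> and \<open>x = (x1, x2)\<close>, the system says
  \<open>- x3 A x = k x\<close> and \<open>x \<sqdot> A x = - k x3\<close>.  If \<open>x\<close> and \<open>x3\<close> are both nonzero, then either \<open>k = 0\<close> and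
  \<open>A x = 0\<close>, or \<open>X\<close> is null and \<open>x\<close> is an eigenvector; the last quadratic form of the
  classification is the determinant of \<open>x\<close> and \<open>A x\<close>.\<close>

lemma g5_geodesic_system:
  fixes x1 x2 x3 \<alpha> \<beta> \<gamma> \<delta> :: real
  assumes orth: "\<alpha> * \<gamma> + \<beta> * \<delta> = 0" 
  shows "(\<exists>k. - x3 * (\<alpha> * x1 + \<beta> * x2) = k * x1 \<and> - x3 * (\<gamma> * x1 + \<delta> * x2) = k * x2 \<and>
        x1 * (\<alpha> * x1 + \<beta> * x2) + x2 * (\<gamma> * x1 + \<delta> * x2) = - k * x3)
    \<longleftrightarrow> (x1 = 0 \<and> x2 = 0)
      \<or> (x3 = 0 \<and> \<alpha> * x1\<^sup>2 + (\<beta> + \<gamma>) * x1 * x2 + \<delta> * x2\<^sup>2 = 0)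
      \<or> (\<alpha> = 0 \<and> \<beta> = 0 \<and> \<gamma> * x1 + \<delta> * x2 = 0)
      \<or> (\<gamma> = 0 \<and> \<delta> = 0 \<and> \<alpha> * x1 + \<beta> * x2 = 0)
      \<or> (x3\<^sup>2 = x1\<^sup>2 + x2\<^sup>2 \<and> \<gamma> * x1\<^sup>2 + (\<delta> - \<alpha>) * x1 * x2 - \<beta> * x2\<^sup>2 = 0)"
    (is "?L \<longleftrightarrow> ?R")
proof
  assume ?L
  then obtain k where k: "- x3 * (\<alpha> * x1 + \<beta> * x2) = k * x1" "- x3 * (\<gamma> * x1 + \<delta> * x2) = k * x2"
    "x1 * (\<alpha> * x1 + \<beta> * x2) + x2 * (\<gamma> * x1 + \<delta> * x2) = - k * x3" by blast
  (* This is the geodesic condition for Y = X. *)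
  have null: "k * (x1\<^sup>2 + x2\<^sup>2 - x3\<^sup>2) = 0" using k by algebra
  consider "x1 = 0" "x2 = 0" | "x3 = 0" "x1 \<noteq> 0 \<or> x2 \<noteq> 0" 
    | "x3 \<noteq> 0" "k \<noteq> 0" | "x3 \<noteq> 0" "x1 \<noteq> 0 \<or> x2 \<noteq> 0" "k = 0" by blast
  then show ?R
  proof cases
    case 1
    then show ?thesis by blast
  next
    case 2
    then have "k = 0" using k by auto
    then have "\<alpha> * x1\<^sup>2 + (\<beta> + \<gamma>) * x1 * x2 + \<delta> * x2\<^sup>2 = 0" using k(3) by algebra
    then show ?thesis using 2 by blast
  next
    case 3
    have "x3 * (\<gamma> * x1\<^sup>2 + (\<delta> - \<alpha>) * x1 * x2 - \<beta> * x2\<^sup>2) = 0" using k(1,2) by algebra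
    then show ?thesis using 3 null by simp
  next
    case 4
    then have Ax: "\<alpha> * x1 + \<beta> * x2 = 0" "\<gamma> * x1 + \<delta> * x2 = 0" using k by auto
    have "x1 * (\<alpha> * \<delta> - \<beta> * \<gamma>) = 0" "x2 * (\<alpha> * \<delta> - \<beta> * \<gamma>) = 0" using Ax by algebra+
    then have "\<alpha> * \<delta> - \<beta> * \<gamma> = 0" using 4 by auto
    then have "(\<alpha>\<^sup>2 + \<beta>\<^sup>2) * \<gamma> = 0" "(\<alpha>\<^sup>2 + \<beta>\<^sup>2) * \<delta> = 0" using orth by algebra+
    then have "(\<alpha> = 0 \<and> \<beta> = 0) \<or> (\<gamma> = 0 \<and> \<delta> = 0)" by (auto simp: sum_power2_eq_zero_iff)
    then show ?thesis using Ax by blast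
  qed
next
  assume ?R
  then consider "x1 = 0" "x2 = 0"
    | "x3 = 0" "\<alpha> * x1\<^sup>2 + (\<beta> + \<gamma>) * x1 * x2 + \<delta> * x2\<^sup>2 = 0"
    | "\<alpha> * x1 + \<beta> * x2 = 0" "\<gamma> * x1 + \<delta> * x2 = 0"
    | "x3 \<noteq> 0" "x3\<^sup>2 = x1\<^sup>2 + x2\<^sup>2" "\<gamma> * x1\<^sup>2 + (\<delta> - \<alpha>) * x1 * x2 - \<beta> * x2\<^sup>2 = 0"
    by fastforce
  then show ?L
  proof cases
    case 4
    (* As x3 is nonzero, the third equation determines k. *)
    define k where "k = - (x1 * (\<alpha> * x1 + \<beta> * x2) + x2 * (\<gamma> * x1 + \<delta> * x2)) / x3"
    have k3: "x1 * (\<alpha> * x1 + \<beta> * x2) + x2 * (\<gamma> * x1 + \<delta> * x2) = - k * x3"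
      using 4(1) by (simp add: k_def)
    have "x3 * (- x3 * (\<alpha> * x1 + \<beta> * x2) - k * x1) = 0" "x3 * (- x3 * (\<gamma> * x1 + \<delta> * x2) - k * x2) = 0"
      using k3 4(2,3) by algebra+
    then show ?thesis using k3 4(1) by auto
  qed (rule exI[of _ 0]; simp; algebra)+
qed

text \<open>The argument is the same with \<open>e1\<close> in the place of \<open>e3\<close>, except that the rows
  \<open>(\<alpha>, \<beta>)\<close>, \<open>(\<gamma>, \<delta>)\<close> are orthogonal for a Lorentzian form.  Dependent orthogonal rows then satisfy
  \<open>(\<alpha> - \<beta>) (\<gamma> + \<delta>) = 0\<close> and \<open>(\<alpha> + \<beta>) (\<gamma> - \<delta>) = 0\<close>.  The last two assumptions say that the rows do not
  both lie on the same null line, so one of them vanishes.\<close>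

lemma g6_geodesic_system:
  fixes x1 x2 x3 \<alpha> \<beta> \<gamma> \<delta> :: real
  assumes orth: "\<alpha> * \<gamma> - \<beta> * \<delta> = 0"
    and not_null: "\<not> (\<alpha> = \<beta> \<and> \<gamma> = \<delta>)" "\<not> (\<alpha> = - \<beta> \<and> \<gamma> = - \<delta>)"
  shows "(\<exists>k. - x2 * (\<alpha> * x2 - \<beta> * x3) - x3 * (\<gamma> * x2 - \<delta> * x3) = k * x1 \<and>
        x1 * (\<alpha> * x2 - \<beta> * x3) = k * x2 \<and> x1 * (\<gamma> * x2 - \<delta> * x3) = - k * x3)
    \<longleftrightarrow> (x2 = 0 \<and> x3 = 0)
      \<or> (x1 = 0 \<and> \<alpha> * x2\<^sup>2 + (\<gamma> - \<beta>) * x2 * x3 - \<delta> * x3\<^sup>2 = 0)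
      \<or> (\<alpha> = 0 \<and> \<beta> = 0 \<and> \<gamma> * x2 = \<delta> * x3)
      \<or> (\<gamma> = 0 \<and> \<delta> = 0 \<and> \<alpha> * x2 = \<beta> * x3)
      \<or> (x3\<^sup>2 = x1\<^sup>2 + x2\<^sup>2 \<and> \<gamma> * x2\<^sup>2 + (\<alpha> - \<delta>) * x2 * x3 - \<beta> * x3\<^sup>2 = 0)"
    (is "?L \<longleftrightarrow> ?R")
proof
  assume ?L
  then obtain k where k: "- x2 * (\<alpha> * x2 - \<beta> * x3) - x3 * (\<gamma> * x2 - \<delta> * x3) = k * x1"
    "x1 * (\<alpha> * x2 - \<beta> * x3) = k * x2" "x1 * (\<gamma> * x2 - \<delta> * x3) = - k * x3" by blast
  (* This is the geodesic condition for Y = X. *)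
  have null: "k * (x1\<^sup>2 + x2\<^sup>2 - x3\<^sup>2) = 0" using k by algebra
  consider "x2 = 0" "x3 = 0" | "x1 = 0" "x2 \<noteq> 0 \<or> x3 \<noteq> 0"
    | "x1 \<noteq> 0" "k \<noteq> 0" | "x1 \<noteq> 0" "x2 \<noteq> 0 \<or> x3 \<noteq> 0" "k = 0" by blast
  then show ?R
  proof cases
    case 1
    then show ?thesis by blast
  next
    case 2
    then have "k = 0" using k by auto
    then have "\<alpha> * x2\<^sup>2 + (\<gamma> - \<beta>) * x2 * x3 - \<delta> * x3\<^sup>2 = 0" using k(1) by algebra
    then show ?thesis using 2 by blast
  next
    case 3
    have "x1 * (\<gamma> * x2\<^sup>2 + (\<alpha> - \<delta>) * x2 * x3 - \<beta> * x3\<^sup>2) = 0" using k(2,3) by algebra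
    then show ?thesis using 3 null by simp
  next
    case 4
    then have Ax: "\<alpha> * x2 - \<beta> * x3 = 0" "\<gamma> * x2 - \<delta> * x3 = 0" using k by auto
    have "x2 * (\<alpha> * \<delta> - \<beta> * \<gamma>) = 0" "x3 * (\<alpha> * \<delta> - \<beta> * \<gamma>) = 0" using Ax by algebra+
    then have "\<alpha> * \<delta> - \<beta> * \<gamma> = 0" using 4 by auto
    then have "(\<alpha> - \<beta>) * (\<gamma> + \<delta>) = 0" "(\<alpha> + \<beta>) * (\<gamma> - \<delta>) = 0" using orth by algebra+
    then have "(\<alpha> = 0 \<and> \<beta> = 0) \<or> (\<gamma> = 0 \<and> \<delta> = 0)" using not_null by fastforce
    then show ?thesis using Ax by fastforce
  qed
next
  assume ?R
  then consider "x2 = 0" "x3 = 0"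
    | "x1 = 0" "\<alpha> * x2\<^sup>2 + (\<gamma> - \<beta>) * x2 * x3 - \<delta> * x3\<^sup>2 = 0"
    | "\<alpha> * x2 - \<beta> * x3 = 0" "\<gamma> * x2 - \<delta> * x3 = 0"
    | "x3 \<noteq> 0" "x3\<^sup>2 = x1\<^sup>2 + x2\<^sup>2" "\<gamma> * x2\<^sup>2 + (\<alpha> - \<delta>) * x2 * x3 - \<beta> * x3\<^sup>2 = 0"
    by fastforce
  then show ?L
  proof cases
    case 4
    (* As x3 is nonzero, the third equation determines k. *)
    define k where "k = - (x1 * (\<gamma> * x2 - \<delta> * x3)) / x3"
    have k3: "x1 * (\<gamma> * x2 - \<delta> * x3) = - k * x3" using 4(1) by (simp add: k_def)
    have k2: "x3 * (x1 * (\<alpha> * x2 - \<beta> * x3) - k * x2) = 0" using k3 4(2,3) by algebra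
    have k1: "x3 * (- x2 * (\<alpha> * x2 - \<beta> * x3) - x3 * (\<gamma> * x2 - \<delta> * x3) - k * x1) = 0"
      using k3 4(2,3) by algebra
    show ?thesis using k3 k2 k1 4(1) by auto
  qed (rule exI[of _ 0]; simp; algebra)+
qed

text \<open>Here \<open>w\<close> and \<open>p\<close> are the inner products of \<open>X\<close> with \<open>e2 + e3\<close> and \<open>e2 - e3\<close>, so \<open>X\<close> is null iff
  \<open>x1\<^sup>2 + p w = 0\<close>.  The sum of the last two equations gives \<open>k = \<gamma> x1 + \<delta> w\<close> unless \<open>w = 0\<close>.
  In the last family the linear equation parametrises a plane, and the quadratic one cuts out the
  null vectors in it.\<close>

lemma g7_geodesic_system_nonzero_\<gamma>:
  fixes x1 x2 x3 \<beta> \<gamma> \<delta> :: real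
  assumes "\<gamma> \<noteq> 0" "\<delta> \<noteq> 0"
  defines "w \<equiv> x2 - x3" and "p \<equiv> x2 + x3"
  shows "(\<exists>k. \<beta> * w\<^sup>2 = k * x1 \<and>
        - \<beta> * x1 * w - x3 * (\<gamma> * x1 + \<delta> * w) = k * x2 \<and>
        \<beta> * x1 * w + x2 * (\<gamma> * x1 + \<delta> * w) = - k * x3)
    \<longleftrightarrow> (x2 = 0 \<and> x3 = 0) \<or> (x1 = 0 \<and> w = 0)
      \<or> (\<beta> = 0 \<and> \<gamma> * x1 + \<delta> * w = 0)
      \<or> (\<delta> * x1 = \<beta> * w + \<gamma> * p \<and> (\<beta> * w + \<gamma> * p)\<^sup>2 + \<delta>\<^sup>2 * (p * w) = 0)"
    (is "?L \<longleftrightarrow> ?R")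
proof
  assume ?L
  then obtain k where k: "\<beta> * w\<^sup>2 = k * x1" 
    "- \<beta> * x1 * w - x3 * (\<gamma> * x1 + \<delta> * w) = k * x2"
    "\<beta> * x1 * w + x2 * (\<gamma> * x1 + \<delta> * w) = - k * x3" by blast
  have null: "k * (x1\<^sup>2 + p * w) = 0" using k unfolding w_def p_def by algebra
  show ?R
  proof (cases "w = 0")
    case True
    then have x23: "x2 = x3" by (simp add: w_def)
    show ?thesis
    proof (cases "x1 = 0")
      case False
      then have "k = 0" using k(1) True by simp
      then have "x3 * (\<gamma> * x1) = 0" using k(2) True by simp
      then show ?thesis using False assms(1) x23 by simp
    qed (use True in blast)
  next
    case False
    have "w * (\<gamma> * x1 + \<delta> * w) = w * k" using k(2,3) unfolding w_def by algebra
    then have k_eq: "k = \<gamma> * x1 + \<delta> * w" using False by simp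
    show ?thesis
    proof (cases "k = 0")
      case True
      then show ?thesis using k(1) k_eq False by simp
    next
      case k0: False
      then have null': "x1\<^sup>2 + p * w = 0" using null by simp
      have "w * (\<delta> * x1 - \<beta> * w - \<gamma> * p) = 0" using k(1) k_eq null' by algebra
      then have "\<delta> * x1 = \<beta> * w + \<gamma> * p" using False by simp
      moreover from this have "(\<beta> * w + \<gamma> * p)\<^sup>2 + \<delta>\<^sup>2 * (p * w) = 0" using null' by algebra
      ultimately show ?thesis by blast
    qed
  qed
next
  assume ?R
  then consider "x2 = 0" "x3 = 0" | "x1 = 0" "w = 0" | "\<beta> = 0" "\<gamma> * x1 + \<delta> * w = 0"
    | "\<delta> * x1 = \<beta> * w + \<gamma> * p" "(\<beta> * w + \<gamma> * p)\<^sup>2 + \<delta>\<^sup>2 * (p * w) = 0" by blast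
  then show ?L
  proof cases
    case 4
    then have "\<delta>\<^sup>2 * (x1\<^sup>2 + p * w) = 0" by algebra
    then have null: "x1\<^sup>2 + p * w = 0" using assms(2) by simp
    define k where "k = \<gamma> * x1 + \<delta> * w"
    have "\<beta> * w\<^sup>2 = k * x1" using 4(1) null unfolding k_def by algebra
    moreover have "\<beta> * x1 * w + p * k = 0" using 4(1) null unfolding k_def by algebra
    ultimately show ?thesis unfolding k_def[symmetric]
      by (intro exI[of _ k]) (simp add: p_def algebra_simps)
  qed (rule exI[of _ 0]; simp add: w_def)+
qed

text \<open>If \<open>w = 0\<close>, the first two equations force \<open>x1 = 0\<close>.  Otherwise \<open>k = \<delta> w\<close> is not zero, so \<open>X\<close> is null
  and \<open>(\<alpha> - \<delta>) x1 = - \<beta> w\<close>.  These conditions determine \<open>X\<close> up to a factor.\<close>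

lemma g7_geodesic_system_zero_\<gamma>:
  fixes x1 x2 x3 \<alpha> \<beta> \<delta> :: real
  assumes "\<alpha> \<noteq> 0" "\<delta> \<noteq> 0" "\<not> (\<alpha> = \<delta> \<and> \<beta> = 0)"
  defines "w \<equiv> x2 - x3"
  shows "(\<exists>k. w * (\<alpha> * x1 + \<beta> * w) = k * x1 \<and>
        - x1 * (\<alpha> * x1 + \<beta> * w) - x3 * (\<delta> * w) = k * x2 \<and>
        x1 * (\<alpha> * x1 + \<beta> * w) + x2 * (\<delta> * w) = - k * x3)
    \<longleftrightarrow> (x1 = 0 \<and> x2 = x3) \<or> (\<beta> = 0 \<and> x1 = 0 \<and> x3 = - x2)
      \<or> (\<exists>c. x1 = c * (2 * \<beta> * (\<alpha> - \<delta>)) \<and> x2 = c * (\<beta>\<^sup>2 - (\<alpha> - \<delta>)\<^sup>2) \<and>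
             x3 = c * (\<beta>\<^sup>2 + (\<alpha> - \<delta>)\<^sup>2))"
    (is "?L \<longleftrightarrow> ?R")
proof
  assume ?L
  then obtain k where k: "w * (\<alpha> * x1 + \<beta> * w) = k * x1"
    "- x1 * (\<alpha> * x1 + \<beta> * w) - x3 * (\<delta> * w) = k * x2"
    "x1 * (\<alpha> * x1 + \<beta> * w) + x2 * (\<delta> * w) = - k * x3" by blast
  show ?R
  proof (cases "w = 0")
    case True
    then have "x1 = 0" using k(1,2) assms(1) by auto
    then show ?thesis using True by (simp add: w_def)
  next
    case False
    have "w * (\<delta> * w) = w * k" using k(2,3) unfolding w_def by algebra
    then have k_eq: "k = \<delta> * w" using False by simp
    have "w * ((\<alpha> - \<delta>) * x1 + \<beta> * w) = 0" using k(1) k_eq by algebra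
    then have x1: "(\<alpha> - \<delta>) * x1 = - \<beta> * w" using False by simp
    then have "\<alpha> \<noteq> \<delta>" using assms(3) False by auto
    have "\<delta> * (x1\<^sup>2 + (x2 + x3) * w) = 0" using k(2,3) k_eq x1 by algebra
    then have null: "x1\<^sup>2 + (x2 + x3) * w = 0" using assms(2) by simp
    (* In the third family x2 - x3 is - 2 (\<alpha> - \<delta>)^2 times the factor c. *)
    define c where "c = - w / (2 * (\<alpha> - \<delta>)\<^sup>2)"
    have w: "w = - 2 * (\<alpha> - \<delta>)\<^sup>2 * c" using \<open>\<alpha> \<noteq> \<delta>\<close> by (simp add: c_def)
    have "(\<alpha> - \<delta>) * (x1 - c * (2 * \<beta> * (\<alpha> - \<delta>))) = 0" using x1 w by algebra
    then have x1c: "x1 = c * (2 * \<beta> * (\<alpha> - \<delta>))" using \<open>\<alpha> \<noteq> \<delta>\<close> by simp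
    have "w * (x2 + x3 - c * (2 * \<beta>\<^sup>2)) = 0" using null w x1c by algebra
    then have "x2 + x3 = c * (2 * \<beta>\<^sup>2)" using False by simp
    then have "x2 = c * (\<beta>\<^sup>2 - (\<alpha> - \<delta>)\<^sup>2)" "x3 = c * (\<beta>\<^sup>2 + (\<alpha> - \<delta>)\<^sup>2)"
      using w unfolding w_def by (simp_all add: algebra_simps)
    then show ?thesis using x1c by blast
  qed
next
  assume ?R
  then consider "x1 = 0" "x2 = x3" | "\<beta> = 0" "x1 = 0" "x3 = - x2"
    | c where "x1 = c * (2 * \<beta> * (\<alpha> - \<delta>))" "x2 = c * (\<beta>\<^sup>2 - (\<alpha> - \<delta>)\<^sup>2)"
        "x3 = c * (\<beta>\<^sup>2 + (\<alpha> - \<delta>)\<^sup>2)" by blast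
  then show ?L
  proof cases
    case 3
    show ?thesis
      by (intro exI[of _ "\<delta> * w"] conjI; use 3 in \<open>unfold w_def\<close>; algebra)
  qed (rule exI[of _ "\<delta> * w"]; simp add: w_def algebra_simps)+
qed

context pseudo_orthonormal_lie_algebra
begin

section \<open>Parameters excluded by non-symmetry\<close>

text \<open>When \<open>[e1,e2]\<close> and \<open>[e1,e3]\<close> lie on one null line, the derived algebra is the line of
  \<open>e2 + e3\<close> or of \<open>e2 - e3\<close>; this null vector takes the role of \<open>u\<close>.\<close>

lemma symmetric_g6:
  assumes "form_g6 br e1 e2 e3 \<alpha> \<beta> \<gamma> \<delta>"
    and "(\<alpha> = \<beta> \<and> \<gamma> = \<delta>) \<or> (\<alpha> = - \<beta> \<and> \<gamma> = - \<delta>)"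
  shows "symmetric_metric br ip"
  using assms(2)
proof
  assume "\<alpha> = \<beta> \<and> \<gamma> = \<delta>"
  interpret null_framed_lie_algebra br ip e1 "e2 + e3" "e2 - e3"
    by unfold_locales (rule null_frame_of_basis)
  show ?thesis
    by (rule symmetric_null_derived_line[of "\<beta> + \<delta>" "\<beta> - \<delta>"];
        use assms(1) \<open>\<alpha> = \<beta> \<and> \<gamma> = \<delta>\<close> in
        \<open>simp add: form_g6_def br_simps br_skew[of e3 e2] algebra_simps\<close>)
next
  assume "\<alpha> = - \<beta> \<and> \<gamma> = - \<delta>"
  interpret null_framed_lie_algebra br ip e1 "e2 - e3" "e2 + e3"
    by unfold_locales (rule null_frame_of_basis)
  show ?thesis
    by (rule symmetric_null_derived_line[of "\<delta> - \<beta>" "- \<beta> - \<delta>"];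
        use assms(1) \<open>\<alpha> = - \<beta> \<and> \<gamma> = - \<delta>\<close> in
        \<open>simp add: form_g6_def br_simps br_skew[of e3 e2] algebra_simps\<close>)
qed

lemma symmetric_g7:
  assumes "form_g7 br e1 e2 e3 \<alpha> \<beta> 0 \<delta>" and "\<delta> = 0 \<or> (\<alpha> = \<delta> \<and> \<beta> = 0)"
  shows "symmetric_metric br ip"
proof -
  interpret null_framed_lie_algebra br ip e1 "e2 + e3" "e2 - e3"
    by unfold_locales (rule null_frame_of_basis)
  note br = assms(1)[unfolded form_g7_def]
  have br_frame: "br e1 (e2 + e3) = 0"
    "br e1 (e2 - e3) = - 2 *\<^sub>R (\<alpha> *\<^sub>R e1 + \<beta> *\<^sub>R (e2 + e3))"
    "br (e2 + e3) (e2 - e3) = - 2 *\<^sub>R (\<delta> *\<^sub>R (e2 + e3))"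
    using br by (simp_all add: br_simps br_skew[of e3 e2] vector_eq_iff ip_simps)
  from assms(2) show ?thesis
  proof
    assume "\<delta> = 0"
    then show ?thesis using symmetric_plane_wave br_frame by simp
  next
    assume "\<alpha> = \<delta> \<and> \<beta> = 0"
    then show ?thesis using symmetric_null_special_bracket[of \<delta>] br_frame by simp
  qed
qed

section \<open>Geodesic vectors of the three families\<close>

text \<open>When one row of the matrix vanishes, \<open>\<alpha> + \<delta> \<noteq> 0\<close> forces the diagonal entry of the other row to
  be nonzero, so that a kernel vector is the multiple of \<open>(\<delta>, - \<gamma>)\<close> or \<open>(- \<beta>, \<alpha>)\<close> found by
  dividing one coordinate by that entry.\<close>

lemma geodesic_vectors_g5:
  assumes g5: "form_g5 br e1 e2 e3 \<alpha> \<beta> \<gamma> \<delta>"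
  shows "geodesic_vector br ip X \<longleftrightarrow> X \<noteq> 0 \<and>
         ((\<exists>x3. X = x3 *\<^sub>R e3)
        \<or> (\<exists>x1 x2. X = x1 *\<^sub>R e1 + x2 *\<^sub>R e2 \<and>
             \<alpha> * x1\<^sup>2 + (\<beta> + \<gamma>) * x1 * x2 + \<delta> * x2\<^sup>2 = 0)
        \<or> (\<alpha> = 0 \<and> \<beta> = 0 \<and>
             (\<exists>x1 x3. X = x1 *\<^sub>R (\<delta> *\<^sub>R e1 - \<gamma> *\<^sub>R e2) + x3 *\<^sub>R e3))
        \<or> (\<gamma> = 0 \<and> \<delta> = 0 \<and>
             (\<exists>x2 x3. X = x2 *\<^sub>R (- \<beta> *\<^sub>R e1 + \<alpha> *\<^sub>R e2) + x3 *\<^sub>R e3))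
        \<or> (\<exists>x1 x2. (X = x1 *\<^sub>R e1 + x2 *\<^sub>R e2 + sqrt (x1\<^sup>2 + x2\<^sup>2) *\<^sub>R e3 \<or>
                    X = x1 *\<^sub>R e1 + x2 *\<^sub>R e2 - sqrt (x1\<^sup>2 + x2\<^sup>2) *\<^sub>R e3) \<and>
             \<gamma> * x1\<^sup>2 + (\<delta> - \<alpha>) * x1 * x2 - \<beta> * x2\<^sup>2 = 0))"
proof -
  obtain x1 x2 x3 where X: "X = x1 *\<^sub>R e1 + x2 *\<^sub>R e2 + x3 *\<^sub>R e3"
    by (rule exists_coordinates)
  have coeffs: "\<alpha> + \<delta> \<noteq> 0" "\<alpha> * \<gamma> + \<beta> * \<delta> = 0" using g5 by (simp_all add: form_g5_def)
  have ips: "ip (br e1 e2) X = 0" "ip (br e1 e3) X = \<alpha> * x1 + \<beta> * x2"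
    "ip (br e2 e3) X = \<gamma> * x1 + \<delta> * x2"
    by (simp_all add: g5[unfolded form_g5_def] X ip_simps)
  note vec = X vector_eq_iff ip_simps
  have d1: "(\<exists>c. X = c *\<^sub>R e3) \<longleftrightarrow> x1 = 0 \<and> x2 = 0" by (auto simp: vec)
  have d2: "(\<exists>a b. X = a *\<^sub>R e1 + b *\<^sub>R e2 \<and> \<alpha> * a\<^sup>2 + (\<beta> + \<gamma>) * a * b + \<delta> * b\<^sup>2 = 0)
      \<longleftrightarrow> x3 = 0 \<and> \<alpha> * x1\<^sup>2 + (\<beta> + \<gamma>) * x1 * x2 + \<delta> * x2\<^sup>2 = 0"
    by (auto simp: vec)
  have d3: "(\<alpha> = 0 \<and> \<beta> = 0 \<and> (\<exists>a c. X = a *\<^sub>R (\<delta> *\<^sub>R e1 - \<gamma> *\<^sub>R e2) + c *\<^sub>R e3))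
      \<longleftrightarrow> \<alpha> = 0 \<and> \<beta> = 0 \<and> \<gamma> * x1 + \<delta> * x2 = 0"
  proof (intro conj_cong refl iffI)
    assume "\<alpha> = 0" "\<gamma> * x1 + \<delta> * x2 = 0"
    then have "X = (x1 / \<delta>) *\<^sub>R (\<delta> *\<^sub>R e1 - \<gamma> *\<^sub>R e2) + x3 *\<^sub>R e3"
      using coeffs by (simp add: vec field_simps)
    then show "\<exists>a c. X = a *\<^sub>R (\<delta> *\<^sub>R e1 - \<gamma> *\<^sub>R e2) + c *\<^sub>R e3" by blast
  qed (auto simp: vec)
  have d4: "(\<gamma> = 0 \<and> \<delta> = 0 \<and> (\<exists>b c. X = b *\<^sub>R (- \<beta> *\<^sub>R e1 + \<alpha> *\<^sub>R e2) + c *\<^sub>R e3))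
      \<longleftrightarrow> \<gamma> = 0 \<and> \<delta> = 0 \<and> \<alpha> * x1 + \<beta> * x2 = 0"
  proof (intro conj_cong refl iffI)
    assume "\<delta> = 0" "\<alpha> * x1 + \<beta> * x2 = 0"
    then have "X = (x2 / \<alpha>) *\<^sub>R (- \<beta> *\<^sub>R e1 + \<alpha> *\<^sub>R e2) + x3 *\<^sub>R e3"
      using coeffs by (simp add: vec field_simps)
    then show "\<exists>b c. X = b *\<^sub>R (- \<beta> *\<^sub>R e1 + \<alpha> *\<^sub>R e2) + c *\<^sub>R e3" by blast
  qed (auto simp: vec)
  have d5: "(\<exists>a b. (X = a *\<^sub>R e1 + b *\<^sub>R e2 + sqrt (a\<^sup>2 + b\<^sup>2) *\<^sub>R e3 \<or>
                    X = a *\<^sub>R e1 + b *\<^sub>R e2 - sqrt (a\<^sup>2 + b\<^sup>2) *\<^sub>R e3) \<and>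
             \<gamma> * a\<^sup>2 + (\<delta> - \<alpha>) * a * b - \<beta> * b\<^sup>2 = 0)
      \<longleftrightarrow> x3\<^sup>2 = x1\<^sup>2 + x2\<^sup>2 \<and> \<gamma> * x1\<^sup>2 + (\<delta> - \<alpha>) * x1 * x2 - \<beta> * x2\<^sup>2 = 0"
    using square_eq_iff_sqrt[where x = x3 and y = "x1\<^sup>2 + x2\<^sup>2"]
    by (auto simp: vec minus_equation_iff[of x3] conj_disj_distribR ex_disj_distrib)
  show ?thesis
    unfolding d1 d2 d3 d4 d5 g5_geodesic_system[OF coeffs(2), symmetric]
      geodesic_vector_coordinates[OF X] ips by simp
qed

lemma geodesic_vectors_g6:
  assumes g6: "form_g6 br e1 e2 e3 \<alpha> \<beta> \<gamma> \<delta>" and "\<not> symmetric_metric br ip"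
  shows "geodesic_vector br ip X \<longleftrightarrow> X \<noteq> 0 \<and>
         ((\<exists>x1. X = x1 *\<^sub>R e1)
        \<or> (\<exists>x2 x3. X = x2 *\<^sub>R e2 + x3 *\<^sub>R e3 \<and>
             \<alpha> * x2\<^sup>2 + (\<gamma> - \<beta>) * x2 * x3 - \<delta> * x3\<^sup>2 = 0)
        \<or> (\<alpha> = 0 \<and> \<beta> = 0 \<and>
             (\<exists>x1 x2. X = x1 *\<^sub>R e1 + x2 *\<^sub>R (\<delta> *\<^sub>R e2 + \<gamma> *\<^sub>R e3)))
        \<or> (\<gamma> = 0 \<and> \<delta> = 0 \<and>
             (\<exists>x1 x3. X = x1 *\<^sub>R e1 + x3 *\<^sub>R (\<beta> *\<^sub>R e2 + \<alpha> *\<^sub>R e3)))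
        \<or> (\<exists>x1 x2 x3. X = x1 *\<^sub>R e1 + x2 *\<^sub>R e2 + x3 *\<^sub>R e3 \<and>
             (x3 = sqrt (x1\<^sup>2 + x2\<^sup>2) \<or> x3 = - sqrt (x1\<^sup>2 + x2\<^sup>2)) \<and>
             \<gamma> * x2\<^sup>2 + (\<alpha> - \<delta>) * x2 * x3 - \<beta> * x3\<^sup>2 = 0))"
proof -
  obtain x1 x2 x3 where X: "X = x1 *\<^sub>R e1 + x2 *\<^sub>R e2 + x3 *\<^sub>R e3"
    by (rule exists_coordinates)
  have coeffs: "\<alpha> + \<delta> \<noteq> 0" "\<alpha> * \<gamma> - \<beta> * \<delta> = 0"
    "\<not> (\<alpha> = \<beta> \<and> \<gamma> = \<delta>)" "\<not> (\<alpha> = - \<beta> \<and> \<gamma> = - \<delta>)"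
    using g6 symmetric_g6[OF g6] assms(2) unfolding form_g6_def by blast+
  have ips: "ip (br e1 e2) X = \<alpha> * x2 - \<beta> * x3" "ip (br e1 e3) X = \<gamma> * x2 - \<delta> * x3"
    "ip (br e2 e3) X = 0"
    by (simp_all add: g6[unfolded form_g6_def] X ip_simps)
  note vec = X vector_eq_iff ip_simps
  have d1: "(\<exists>a. X = a *\<^sub>R e1) \<longleftrightarrow> x2 = 0 \<and> x3 = 0" by (auto simp: vec)
  have d2: "(\<exists>b c. X = b *\<^sub>R e2 + c *\<^sub>R e3 \<and> \<alpha> * b\<^sup>2 + (\<gamma> - \<beta>) * b * c - \<delta> * c\<^sup>2 = 0)
      \<longleftrightarrow> x1 = 0 \<and> \<alpha> * x2\<^sup>2 + (\<gamma> - \<beta>) * x2 * x3 - \<delta> * x3\<^sup>2 = 0"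
    by (auto simp: vec)
  have d3: "(\<alpha> = 0 \<and> \<beta> = 0 \<and> (\<exists>a b. X = a *\<^sub>R e1 + b *\<^sub>R (\<delta> *\<^sub>R e2 + \<gamma> *\<^sub>R e3)))
      \<longleftrightarrow> \<alpha> = 0 \<and> \<beta> = 0 \<and> \<gamma> * x2 = \<delta> * x3"
  proof (intro conj_cong refl iffI)
    assume "\<alpha> = 0" "\<gamma> * x2 = \<delta> * x3"
    then have "X = x1 *\<^sub>R e1 + (x2 / \<delta>) *\<^sub>R (\<delta> *\<^sub>R e2 + \<gamma> *\<^sub>R e3)"
      using coeffs by (simp add: vec field_simps)
    then show "\<exists>a b. X = a *\<^sub>R e1 + b *\<^sub>R (\<delta> *\<^sub>R e2 + \<gamma> *\<^sub>R e3)" by blast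
  qed (auto simp: vec)
  have d4: "(\<gamma> = 0 \<and> \<delta> = 0 \<and> (\<exists>a c. X = a *\<^sub>R e1 + c *\<^sub>R (\<beta> *\<^sub>R e2 + \<alpha> *\<^sub>R e3)))
      \<longleftrightarrow> \<gamma> = 0 \<and> \<delta> = 0 \<and> \<alpha> * x2 = \<beta> * x3"
  proof (intro conj_cong refl iffI)
    assume "\<delta> = 0" "\<alpha> * x2 = \<beta> * x3"
    then have "X = x1 *\<^sub>R e1 + (x3 / \<alpha>) *\<^sub>R (\<beta> *\<^sub>R e2 + \<alpha> *\<^sub>R e3)"
      using coeffs by (simp add: vec field_simps)
    then show "\<exists>a c. X = a *\<^sub>R e1 + c *\<^sub>R (\<beta> *\<^sub>R e2 + \<alpha> *\<^sub>R e3)" by blast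
  qed (auto simp: vec)
  have d5: "(\<exists>a b c. X = a *\<^sub>R e1 + b *\<^sub>R e2 + c *\<^sub>R e3 \<and>
             (c = sqrt (a\<^sup>2 + b\<^sup>2) \<or> c = - sqrt (a\<^sup>2 + b\<^sup>2)) \<and>
             \<gamma> * b\<^sup>2 + (\<alpha> - \<delta>) * b * c - \<beta> * c\<^sup>2 = 0)
      \<longleftrightarrow> x3\<^sup>2 = x1\<^sup>2 + x2\<^sup>2 \<and> \<gamma> * x2\<^sup>2 + (\<alpha> - \<delta>) * x2 * x3 - \<beta> * x3\<^sup>2 = 0"
    using square_eq_iff_sqrt[where x = x3 and y = "x1\<^sup>2 + x2\<^sup>2"] by (auto simp: vec)
  show ?thesis
    unfolding d1 d2 d3 d4 d5 g6_geodesic_system[OF coeffs(2-4), symmetric]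
      geodesic_vector_coordinates[OF X] ips by simp
qed

lemma geodesic_vectors_g7_nonzero_\<gamma>:
  assumes g7: "form_g7 br e1 e2 e3 0 \<beta> \<gamma> \<delta>" and "\<gamma> \<noteq> 0"
  shows "geodesic_vector br ip X \<longleftrightarrow> X \<noteq> 0 \<and>
         ((\<exists>x1. X = x1 *\<^sub>R e1)
        \<or> (\<exists>x2. X = x2 *\<^sub>R (e2 + e3))
        \<or> (\<beta> = 0 \<and>
             (\<exists>x2 x3. X = (- (\<delta> / \<gamma>) * (x2 - x3)) *\<^sub>R e1 + x2 *\<^sub>R e2 + x3 *\<^sub>R e3))
        \<or> (\<exists>x2 x3. X = ((\<beta> + \<gamma>) / \<delta> * x2 - (\<beta> - \<gamma>) / \<delta> * x3) *\<^sub>R e1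
                         + x2 *\<^sub>R e2 + x3 *\<^sub>R e3 \<and>
             ((\<beta> + \<gamma>)\<^sup>2 + \<delta>\<^sup>2) * x2\<^sup>2 - 2 * (\<beta>\<^sup>2 - \<gamma>\<^sup>2) * x2 * x3
               + ((\<beta> - \<gamma>)\<^sup>2 - \<delta>\<^sup>2) * x3\<^sup>2 = 0))"
proof -
  obtain x1 x2 x3 where X: "X = x1 *\<^sub>R e1 + x2 *\<^sub>R e2 + x3 *\<^sub>R e3"
    by (rule exists_coordinates)
  have "\<delta> \<noteq> 0" using g7 by (simp add: form_g7_def)
  have ips: "ip (br e1 e2) X = - \<beta> * (x2 - x3)" "ip (br e1 e3) X = \<beta> * (x2 - x3)"
    "ip (br e2 e3) X = \<gamma> * x1 + \<delta> * (x2 - x3)"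
    by (simp_all add: g7[unfolded form_g7_def] X ip_simps algebra_simps)
  note vec = X vector_eq_iff ip_simps
  have d1: "(\<exists>a. X = a *\<^sub>R e1) \<longleftrightarrow> x2 = 0 \<and> x3 = 0" by (auto simp: vec)
  have d2: "(\<exists>b. X = b *\<^sub>R (e2 + e3)) \<longleftrightarrow> x1 = 0 \<and> x2 - x3 = 0" by (auto simp: vec)
  have d3: "(\<exists>b c. X = (- (\<delta> / \<gamma>) * (b - c)) *\<^sub>R e1 + b *\<^sub>R e2 + c *\<^sub>R e3)
      \<longleftrightarrow> \<gamma> * x1 + \<delta> * (x2 - x3) = 0"
  proof -
    have "(\<exists>b c. X = (- (\<delta> / \<gamma>) * (b - c)) *\<^sub>R e1 + b *\<^sub>R e2 + c *\<^sub>R e3)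
        \<longleftrightarrow> x1 = - (\<delta> / \<gamma>) * (x2 - x3)" by (auto simp: vec)
    then show ?thesis using \<open>\<gamma> \<noteq> 0\<close> by (auto simp: field_simps)
  qed
  have d4: "(\<exists>b c. X = ((\<beta> + \<gamma>) / \<delta> * b - (\<beta> - \<gamma>) / \<delta> * c) *\<^sub>R e1 + b *\<^sub>R e2 + c *\<^sub>R e3 \<and>
             ((\<beta> + \<gamma>)\<^sup>2 + \<delta>\<^sup>2) * b\<^sup>2 - 2 * (\<beta>\<^sup>2 - \<gamma>\<^sup>2) * b * c
               + ((\<beta> - \<gamma>)\<^sup>2 - \<delta>\<^sup>2) * c\<^sup>2 = 0)
      \<longleftrightarrow> \<delta> * x1 = \<beta> * (x2 - x3) + \<gamma> * (x2 + x3) \<and>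
        (\<beta> * (x2 - x3) + \<gamma> * (x2 + x3))\<^sup>2 + \<delta>\<^sup>2 * ((x2 + x3) * (x2 - x3)) = 0"
  proof -
    have "(\<exists>b c. X = ((\<beta> + \<gamma>) / \<delta> * b - (\<beta> - \<gamma>) / \<delta> * c) *\<^sub>R e1 + b *\<^sub>R e2 + c *\<^sub>R e3 \<and>
             ((\<beta> + \<gamma>)\<^sup>2 + \<delta>\<^sup>2) * b\<^sup>2 - 2 * (\<beta>\<^sup>2 - \<gamma>\<^sup>2) * b * c
               + ((\<beta> - \<gamma>)\<^sup>2 - \<delta>\<^sup>2) * c\<^sup>2 = 0)
        \<longleftrightarrow> x1 = (\<beta> + \<gamma>) / \<delta> * x2 - (\<beta> - \<gamma>) / \<delta> * x3 \<and>
          ((\<beta> + \<gamma>)\<^sup>2 + \<delta>\<^sup>2) * x2\<^sup>2 - 2 * (\<beta>\<^sup>2 - \<gamma>\<^sup>2) * x2 * x3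
               + ((\<beta> - \<gamma>)\<^sup>2 - \<delta>\<^sup>2) * x3\<^sup>2 = 0"
      by (auto simp: vec)
    moreover have "x1 = (\<beta> + \<gamma>) / \<delta> * x2 - (\<beta> - \<gamma>) / \<delta> * x3
        \<longleftrightarrow> \<delta> * x1 = \<beta> * (x2 - x3) + \<gamma> * (x2 + x3)"
    proof -
      have x1: "(\<beta> + \<gamma>) / \<delta> * x2 - (\<beta> - \<gamma>) / \<delta> * x3 = (\<beta> * (x2 - x3) + \<gamma> * (x2 + x3)) / \<delta>"
        using \<open>\<delta> \<noteq> 0\<close> by (simp add: field_simps)
      show ?thesis unfolding x1 using \<open>\<delta> \<noteq> 0\<close> by (simp add: eq_divide_eq mult.commute)
    qed
    moreover have "((\<beta> + \<gamma>)\<^sup>2 + \<delta>\<^sup>2) * x2\<^sup>2 - 2 * (\<beta>\<^sup>2 - \<gamma>\<^sup>2) * x2 * x3 + ((\<beta> - \<gamma>)\<^sup>2 - \<delta>\<^sup>2) * x3\<^sup>2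
        = (\<beta> * (x2 - x3) + \<gamma> * (x2 + x3))\<^sup>2 + \<delta>\<^sup>2 * ((x2 + x3) * (x2 - x3))"
      by algebra
    ultimately show ?thesis by simp
  qed
  (* Only the notation changes: the left side is the form in which the coordinates give the system. *)
  have system: "(\<exists>k. - x2 * (- \<beta> * (x2 - x3)) - x3 * (\<beta> * (x2 - x3)) = k * x1 \<and>
      x1 * (- \<beta> * (x2 - x3)) - x3 * (\<gamma> * x1 + \<delta> * (x2 - x3)) = k * x2 \<and>
      x1 * (\<beta> * (x2 - x3)) + x2 * (\<gamma> * x1 + \<delta> * (x2 - x3)) = - k * x3)
    \<longleftrightarrow> (\<exists>k. \<beta> * (x2 - x3)\<^sup>2 = k * x1 \<and>
      - \<beta> * x1 * (x2 - x3) - x3 * (\<gamma> * x1 + \<delta> * (x2 - x3)) = k * x2 \<and>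
      \<beta> * x1 * (x2 - x3) + x2 * (\<gamma> * x1 + \<delta> * (x2 - x3)) = - k * x3)"
    by (simp add: power2_eq_square algebra_simps)
  show ?thesis
    unfolding d1 d2 d3 d4 g7_geodesic_system_nonzero_\<gamma>[OF \<open>\<gamma> \<noteq> 0\<close> \<open>\<delta> \<noteq> 0\<close>, symmetric]
      geodesic_vector_coordinates[OF X] ips system by simp
qed

lemma geodesic_vectors_g7_zero_\<gamma>:
  assumes g7: "form_g7 br e1 e2 e3 \<alpha> \<beta> 0 \<delta>" and "\<alpha> \<noteq> 0" and "\<not> symmetric_metric br ip"
  shows "geodesic_vector br ip X \<longleftrightarrow> X \<noteq> 0 \<and>
         ((\<exists>x2. X = x2 *\<^sub>R (e2 + e3))
        \<or> (\<beta> = 0 \<and> (\<exists>x2. X = x2 *\<^sub>R (e2 - e3)))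
        \<or> (\<exists>x3. X = x3 *\<^sub>R ((2 * \<beta> * (\<alpha> - \<delta>)) *\<^sub>R e1
                              + (\<beta>\<^sup>2 - (\<alpha> - \<delta>)\<^sup>2) *\<^sub>R e2
                              + (\<beta>\<^sup>2 + (\<alpha> - \<delta>)\<^sup>2) *\<^sub>R e3)))"
proof -
  obtain x1 x2 x3 where X: "X = x1 *\<^sub>R e1 + x2 *\<^sub>R e2 + x3 *\<^sub>R e3"
    by (rule exists_coordinates)
  have coeffs: "\<delta> \<noteq> 0" "\<not> (\<alpha> = \<delta> \<and> \<beta> = 0)" using symmetric_g7[OF g7] assms(3) by blast+
  have ips: "ip (br e1 e2) X = - (\<alpha> * x1 + \<beta> * (x2 - x3))"
    "ip (br e1 e3) X = \<alpha> * x1 + \<beta> * (x2 - x3)" "ip (br e2 e3) X = \<delta> * (x2 - x3)"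
    by (simp_all add: g7[unfolded form_g7_def] X ip_simps algebra_simps)
  note vec = X vector_eq_iff ip_simps
  have d1: "(\<exists>b. X = b *\<^sub>R (e2 + e3)) \<longleftrightarrow> x1 = 0 \<and> x2 = x3" by (auto simp: vec)
  have d2: "(\<exists>b. X = b *\<^sub>R (e2 - e3)) \<longleftrightarrow> x1 = 0 \<and> x3 = - x2" by (auto simp: vec)
  have d3: "(\<exists>c. X = c *\<^sub>R ((2 * \<beta> * (\<alpha> - \<delta>)) *\<^sub>R e1 + (\<beta>\<^sup>2 - (\<alpha> - \<delta>)\<^sup>2) *\<^sub>R e2
        + (\<beta>\<^sup>2 + (\<alpha> - \<delta>)\<^sup>2) *\<^sub>R e3))
      \<longleftrightarrow> (\<exists>c. x1 = c * (2 * \<beta> * (\<alpha> - \<delta>)) \<and> x2 = c * (\<beta>\<^sup>2 - (\<alpha> - \<delta>)\<^sup>2) \<and>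
             x3 = c * (\<beta>\<^sup>2 + (\<alpha> - \<delta>)\<^sup>2))"
  proof -
    have "- x3 = c * (- \<beta>\<^sup>2 - (\<alpha> - \<delta>)\<^sup>2) \<longleftrightarrow> x3 = c * (\<beta>\<^sup>2 + (\<alpha> - \<delta>)\<^sup>2)" for c
      by (auto simp: algebra_simps)
    then show ?thesis by (simp add: vec)
  qed
  (* Only the notation changes: the left side is the form in which the coordinates give the system. *)
  have system: "(\<exists>k. - x2 * - (\<alpha> * x1 + \<beta> * (x2 - x3)) - x3 * (\<alpha> * x1 + \<beta> * (x2 - x3)) = k * x1 \<and>
      x1 * - (\<alpha> * x1 + \<beta> * (x2 - x3)) - x3 * (\<delta> * (x2 - x3)) = k * x2 \<and>
      x1 * (\<alpha> * x1 + \<beta> * (x2 - x3)) + x2 * (\<delta> * (x2 - x3)) = - k * x3)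
    \<longleftrightarrow> (\<exists>k. (x2 - x3) * (\<alpha> * x1 + \<beta> * (x2 - x3)) = k * x1 \<and>
      - x1 * (\<alpha> * x1 + \<beta> * (x2 - x3)) - x3 * (\<delta> * (x2 - x3)) = k * x2 \<and>
      x1 * (\<alpha> * x1 + \<beta> * (x2 - x3)) + x2 * (\<delta> * (x2 - x3)) = - k * x3)"
    by (simp add: algebra_simps)
  show ?thesis
    unfolding d1 d2 d3 g7_geodesic_system_zero_\<gamma>[OF \<open>\<alpha> \<noteq> 0\<close> coeffs, symmetric]
      geodesic_vector_coordinates[OF X] ips system by simp
qed

end

theorem proposition3p5:
  fixes br :: "'a::real_vector \<Rightarrow> 'a \<Rightarrow> 'a"
    and ip :: "'a \<Rightarrow> 'a \<Rightarrow> real"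
    and e1 e2 e3 :: 'a
    and \<alpha> \<beta> \<gamma> \<delta> :: real
  assumes "lie_bracket br"
    and "lorentzian_inner_product ip"
    and "\<not> unimodular br"
    and "\<not> symmetric_metric br ip"
    and "pseudo_orthonormal_basis ip e1 e2 e3"
  shows
    "(form_g5 br e1 e2 e3 \<alpha> \<beta> \<gamma> \<delta> \<and> (\<gamma>, \<delta>) \<noteq> (- \<beta>, \<alpha>) \<longrightarrow>
       (\<forall>X. geodesic_vector br ip X \<longleftrightarrow> X \<noteq> 0 \<and>
         ((\<exists>x3. X = x3 *\<^sub>R e3)
        \<or> (\<exists>x1 x2. X = x1 *\<^sub>R e1 + x2 *\<^sub>R e2 \<and>
             \<alpha> * x1\<^sup>2 + (\<beta> + \<gamma>) * x1 * x2 + \<delta> * x2\<^sup>2 = 0)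
        \<or> (\<alpha> = 0 \<and> \<beta> = 0 \<and>
             (\<exists>x1 x3. X = x1 *\<^sub>R (\<delta> *\<^sub>R e1 - \<gamma> *\<^sub>R e2) + x3 *\<^sub>R e3))
        \<or> (\<gamma> = 0 \<and> \<delta> = 0 \<and>
             (\<exists>x2 x3. X = x2 *\<^sub>R (- \<beta> *\<^sub>R e1 + \<alpha> *\<^sub>R e2) + x3 *\<^sub>R e3))
        \<or> (\<exists>x1 x2. (X = x1 *\<^sub>R e1 + x2 *\<^sub>R e2 + sqrt (x1\<^sup>2 + x2\<^sup>2) *\<^sub>R e3 \<or>
                    X = x1 *\<^sub>R e1 + x2 *\<^sub>R e2 - sqrt (x1\<^sup>2 + x2\<^sup>2) *\<^sub>R e3) \<and>
             \<gamma> * x1\<^sup>2 + (\<delta> - \<alpha>) * x1 * x2 - \<beta> * x2\<^sup>2 = 0))))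
   \<and>
     (form_g6 br e1 e2 e3 \<alpha> \<beta> \<gamma> \<delta> \<and> (\<gamma>, \<delta>) \<noteq> (\<beta>, \<alpha>) \<longrightarrow>
       (\<forall>X. geodesic_vector br ip X \<longleftrightarrow> X \<noteq> 0 \<and>
         ((\<exists>x1. X = x1 *\<^sub>R e1)
        \<or> (\<exists>x2 x3. X = x2 *\<^sub>R e2 + x3 *\<^sub>R e3 \<and>
             \<alpha> * x2\<^sup>2 + (\<gamma> - \<beta>) * x2 * x3 - \<delta> * x3\<^sup>2 = 0)
        \<or> (\<alpha> = 0 \<and> \<beta> = 0 \<and>
             (\<exists>x1 x2. X = x1 *\<^sub>R e1 + x2 *\<^sub>R (\<delta> *\<^sub>R e2 + \<gamma> *\<^sub>R e3)))
        \<or> (\<gamma> = 0 \<and> \<delta> = 0 \<and>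
             (\<exists>x1 x3. X = x1 *\<^sub>R e1 + x3 *\<^sub>R (\<beta> *\<^sub>R e2 + \<alpha> *\<^sub>R e3)))
        \<or> (\<exists>x1 x2 x3. X = x1 *\<^sub>R e1 + x2 *\<^sub>R e2 + x3 *\<^sub>R e3 \<and>
             (x3 = sqrt (x1\<^sup>2 + x2\<^sup>2) \<or> x3 = - sqrt (x1\<^sup>2 + x2\<^sup>2)) \<and>
             \<gamma> * x2\<^sup>2 + (\<alpha> - \<delta>) * x2 * x3 - \<beta> * x3\<^sup>2 = 0))))
   \<and>
     (form_g7 br e1 e2 e3 \<alpha> \<beta> \<gamma> \<delta> \<and> \<alpha> = 0 \<and> \<gamma> \<noteq> 0 \<longrightarrow>
       (\<forall>X. geodesic_vector br ip X \<longleftrightarrow> X \<noteq> 0 \<and>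
         ((\<exists>x1. X = x1 *\<^sub>R e1)
        \<or> (\<exists>x2. X = x2 *\<^sub>R (e2 + e3))
        \<or> (\<beta> = 0 \<and>
             (\<exists>x2 x3. X = (- (\<delta> / \<gamma>) * (x2 - x3)) *\<^sub>R e1 + x2 *\<^sub>R e2 + x3 *\<^sub>R e3))
        \<or> (\<exists>x2 x3. X = ((\<beta> + \<gamma>) / \<delta> * x2 - (\<beta> - \<gamma>) / \<delta> * x3) *\<^sub>R e1
                         + x2 *\<^sub>R e2 + x3 *\<^sub>R e3 \<and>
             ((\<beta> + \<gamma>)\<^sup>2 + \<delta>\<^sup>2) * x2\<^sup>2 - 2 * (\<beta>\<^sup>2 - \<gamma>\<^sup>2) * x2 * x3
               + ((\<beta> - \<gamma>)\<^sup>2 - \<delta>\<^sup>2) * x3\<^sup>2 = 0))))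
   \<and>
     (form_g7 br e1 e2 e3 \<alpha> \<beta> \<gamma> \<delta> \<and> \<alpha> \<noteq> 0 \<and> \<gamma> = 0 \<longrightarrow>
       (\<forall>X. geodesic_vector br ip X \<longleftrightarrow> X \<noteq> 0 \<and>
         ((\<exists>x2. X = x2 *\<^sub>R (e2 + e3))
        \<or> (\<beta> = 0 \<and> (\<exists>x2. X = x2 *\<^sub>R (e2 - e3)))
        \<or> (\<exists>x3. X = x3 *\<^sub>R ((2 * \<beta> * (\<alpha> - \<delta>)) *\<^sub>R e1
                              + (\<beta>\<^sup>2 - (\<alpha> - \<delta>)\<^sup>2) *\<^sub>R e2
                              + (\<beta>\<^sup>2 + (\<alpha> - \<delta>)\<^sup>2) *\<^sub>R e3)))))"
proof -
  interpret pseudo_orthonormal_lie_algebra br ip e1 e2 e3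
    using assms by unfold_locales
  note nonsymmetric = assms(4)
  show ?thesis
    apply (intro conjI impI allI; elim conjE)
    subgoal by (rule geodesic_vectors_g5)
    subgoal by (rule geodesic_vectors_g6[OF _ nonsymmetric])
    subgoal using geodesic_vectors_g7_nonzero_\<gamma> by blast
    subgoal using geodesic_vectors_g7_zero_\<gamma>[OF _ _ nonsymmetric] by blast
    done
qed

end
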